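(* Let $n\ge 1$ and $m\ge 0$ be integers with $n\ge 4m$. Then $H_k(\mathbb{Z}_n,c_{m})=0$ for all $k\ge 2$.
   Context: A (Čech) closure space is a pair $(X,c)$ of a set $X$ and a function $c:2^X\to 2^X$ with $c(\varnothing)=\varnothing$, $A\subset c(A)$, and $c(A\cup B)=c(A)\cup c(B)$ for all $A,B\subset X$. Topological spaces are the closure spaces with $c(c(A))=c(A)$ for all $A$, where $c$ is the topological closure. A map $f:(X,c)\to(Y,d)$ is continuous if $f(c(A))\subset d(f(A))$ for all $A\subset X$. $\mathbb{Z}_n=\{0,1,\dots,n-1\}$ with metric $d(i,j)=\min\{|k| : k\equiv i-j \bmod n\}$. For $m\ge 0$, $c_m(i)=\{j\in\mathbb{Z}_n : d(i,j)\le m\}$ and $c_m(A)=\bigcup_{i\in A}c_m(i)$ for $A\subset\mathbb{Z}_n$. Singular homology: let $|\Delta^n|=\{(t_0,\dots,t_n)\in\mathbb{R}^{n+1} : \sum_i t_i=1,\ t_i\ge 0\}=[e_0,\dots,e_n]$ with the Euclidean topology. For a closure space $X$, $C_n(X)$ is the free abelian group on continuous maps $\sigma:|\Delta^n|\to X$ (and $C_n(X)=0$ for $n<0$), $\partial_n(\sigma)=\sum_{i=0}^n(-1)^i\sigma|_{[e_0,\dots,\hat e_i,\dots,e_n]}$, and $H_n(X)=\ker\partial_n/\operatorname{im}\partial_{n+1}$; $H_k(\mathbb{Z}_n,c_m)$ denotes $H_k$ of the closure space $(\mathbb{Z}_n,c_m)$ (not relative homology). *)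

theory Defs
  imports "HOL-Homology.Homology" "HOL-Number_Theory.Cong"
begin

section \<open>Closure spaces\<close>

text \<open>A closure operator is only constrained on subsets of the carrier \<open>X\<close>; its values elsewhere
  are irrelevant.\<close>

definition closure_space :: "'a set \<Rightarrow> ('a set \<Rightarrow> 'a set) \<Rightarrow> bool" where
  "closure_space X c \<longleftrightarrow>
     (\<forall>A. A \<subseteq> X \<longrightarrow> c A \<subseteq> X) \<and>
     c {} = {} \<and>
     (\<forall>A. A \<subseteq> X \<longrightarrow> A \<subseteq> c A) \<and>
     (\<forall>A B. A \<subseteq> X \<longrightarrow> B \<subseteq> X \<longrightarrow> c (A \<union> B) = c A \<union> c B)"

definition closure_continuous ::
    "'a set \<Rightarrow> ('a set \<Rightarrow> 'a set) \<Rightarrow> 'b set \<Rightarrow> ('b set \<Rightarrow> 'b set) \<Rightarrow> ('a \<Rightarrow> 'b) \<Rightarrow> bool" where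
  "closure_continuous X c Y d f \<longleftrightarrow> f \<in> X \<rightarrow> Y \<and> (\<forall>A. A \<subseteq> X \<longrightarrow> f ` c A \<subseteq> d (f ` A))"

lemma closure_space_topology: "closure_space (topspace T) ((closure_of) T)"
  by (simp add: closure_space_def closure_of_subset closure_of_subset_topspace)


section \<open>Singular homology of closure spaces\<close>

text \<open>The simplex \<open>standard_simplex p\<close> consists of the sequences supported on \<open>{..p}\<close> with
  nonnegative entries summing to 1. Its topology as a subspace of the product \<open>UNIV \<Rightarrow> real\<close> is the
  Euclidean one, since all coordinates beyond \<open>p\<close> are constant. As in the library, simplices are
  required to be extensional, so that equal maps on the simplex are equal as HOL functions.\<close>

definition closure_singular_simplex ::
    "nat \<Rightarrow> 'a set \<Rightarrow> ('a set \<Rightarrow> 'a set) \<Rightarrow> ((nat \<Rightarrow> real) \<Rightarrow> 'a) \<Rightarrow> bool" where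
  "closure_singular_simplex p X c f \<longleftrightarrow>
     closure_continuous (standard_simplex p)
       ((closure_of) (subtopology (powertop_real UNIV) (standard_simplex p))) X c f \<and>
     f \<in> extensional (standard_simplex p)"

definition closure_chain_group ::
    "nat \<Rightarrow> 'a set \<Rightarrow> ('a set \<Rightarrow> 'a set) \<Rightarrow> 'a chain monoid" where
  "closure_chain_group p X c = free_Abelian_group {f. closure_singular_simplex p X c f}"

text \<open>The library's \<open>chain_boundary p\<close> is the alternating sum of faces and does not refer to any
  structure on the target; \<open>chain_boundary 0\<close> is the zero map. Hence for \<open>p = 0\<close> the kernel below is
  all of the chain group, whatever the codomain (\<open>p - 1 = 0\<close> on \<open>nat\<close>). Negative degrees, where the
  homology vanishes, are left out.\<close>

definition closure_homology_group ::
    "nat \<Rightarrow> 'a set \<Rightarrow> ('a set \<Rightarrow> 'a set) \<Rightarrow> 'a chain set monoid" where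
  "closure_homology_group p X c =
     subgroup_generated (closure_chain_group p X c)
       (kernel (closure_chain_group p X c) (closure_chain_group (p - 1) X c) (chain_boundary p))
     Mod (chain_boundary (Suc p) ` carrier (closure_chain_group (Suc p) X c))"


text \<open>On topological spaces this is the library's singular homology.\<close>

lemma closure_continuous_topology:
  "closure_continuous (topspace S) ((closure_of) S) (topspace T) ((closure_of) T) f
     \<longleftrightarrow> continuous_map S T f"
  unfolding closure_continuous_def
  by (metis continuous_map_eq_image_closure_subset_alt continuous_map_funspace
      image_subset_iff_funcset)

lemma closure_homology_group_topology:
  "closure_homology_group p (topspace T) ((closure_of) T) = homology_group (int p) T"
proof -
  have simplex: "closure_singular_simplex q (topspace T) ((closure_of) T) = singular_simplex q T" for q
    using closure_continuous_topology[of "subtopology (powertop_real UNIV) (standard_simplex q)" T]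
    by (auto simp: fun_eq_iff closure_singular_simplex_def singular_simplex_def)
  have chain: "closure_chain_group q (topspace T) ((closure_of) T) = chain_group q T" for q
    by (simp add: closure_chain_group_def chain_group_def simplex)
  have "kernel (chain_group p T) (chain_group (p - 1) T) (chain_boundary p)
      = singular_relcycle_set p T {}"
    by (auto simp: kernel_def singular_cycle)
  moreover have "chain_boundary (Suc p) ` carrier (chain_group (Suc p) T)
      = singular_relboundary_set p T {}"
    by (auto simp: singular_boundary)
  ultimately show ?thesis
    by (simp add: closure_homology_group_def chain relative_homology_group_def relcycle_group_def)
qed


section \<open>The closure spaces on the integers modulo n\<close>

definition Zn :: "nat \<Rightarrow> int set" where
  "Zn n = {0..<int n}"

definition Zn_dist :: "nat \<Rightarrow> int \<Rightarrow> int \<Rightarrow> nat" where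
  "Zn_dist n i j = Inf {nat \<bar>k\<bar> |k. [k = i - j] (mod int n)}"

definition Zn_closure :: "nat \<Rightarrow> nat \<Rightarrow> int set \<Rightarrow> int set" where
  "Zn_closure n m A = (\<Union>i\<in>A. {j \<in> Zn n. Zn_dist n i j \<le> m})"

lemma Zn_dist_self [simp]: "Zn_dist n i i = 0"
proof -
  have "0 \<in> {nat \<bar>k\<bar> |k. [k = i - i] (mod int n)}"
    by (rule CollectI, rule exI[of _ 0]) (simp add: cong_refl)
  then have "Zn_dist n i i \<le> 0"
    unfolding Zn_dist_def by (rule cInf_lower) (rule bdd_below_bot)
  then show ?thesis
    by simp
qed

lemma closure_space_Zn: "closure_space (Zn n) (Zn_closure n m)"
proof -
  have "x \<in> Zn_closure n m A" if "A \<subseteq> Zn n" "x \<in> A" for x A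
  proof -
    have "x \<in> {j \<in> Zn n. Zn_dist n x j \<le> m}"
      using that by (simp add: subsetD)
    then show ?thesis
      unfolding Zn_closure_def using that(2) by (rule UN_I[rotated])
  qed
  moreover have "Zn_closure n m A \<subseteq> Zn n" for A
    unfolding Zn_closure_def by (rule UN_least) (rule Collect_restrict)
  moreover have "Zn_closure n m {} = {}"
    unfolding Zn_closure_def by (rule UN_empty)
  moreover have "Zn_closure n m (A \<union> B) = Zn_closure n m A \<union> Zn_closure n m B" for A B
    unfolding Zn_closure_def by (rule UN_Un)
  ultimately show ?thesis
    unfolding closure_space_def by (simp add: subsetI)
qed

end

theory Submission
  imports Defs
begin

text \<open>The space \<open>(\<int>\<^sub>n, c\<^sub>m)\<close> behaves like a circle. It is the quotient of the integers, with
  closure \<open>c(i) = {j. \<bar>j - i\<bar> \<le> m}\<close>, by the translation \<open>t : i \<mapsto> i + n\<close>, and under the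
  hypothesis \<open>n \<ge> 4m\<close>, \<open>n \<ge> 1\<close>, which gives \<open>3m < n\<close>, this quotient map \<open>\<pi>\<close> is a
  covering as far as singular simplices can tell: every simplex of \<open>\<int>\<^sub>n\<close> lifts to the integers
  (lemma \<open>simplex_lift_exists\<close>) and two lifts differ by a power of \<open>t\<close>
  (lemma \<open>simplex_lifts_differ_by_translation\<close>). Hence the singular chains form a short exact sequence

  \<open>0 \<longrightarrow> C(\<int>) \<longrightarrow> C(\<int>) \<longrightarrow> C(\<int>\<^sub>n) \<longrightarrow> 0\<close>

  with maps \<open>t - 1\<close> and \<open>\<pi>\<close> (lemmas \<open>translation_invariant_chain_eq_0\<close>, \<open>kernel_of_projection\<close>
  and \<open>chain_lift_exists\<close>).

  The integers have no homology in positive degrees (lemma \<open>integers_acyclic\<close>): for \<open>m \<ge> 1\<close> clamping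
  all values to the interval from \<open>-s\<close> to \<open>s\<close>, with \<open>s\<close> running from infinity down to 0 in unit
  steps, is a contraction, which turns into a cone operator on simplices; for \<open>m = 0\<close> all simplices
  are constant. The long exact sequence squeezes \<open>H\<^sub>k(\<int>\<^sub>n)\<close> between
  \<open>H\<^sub>k(\<int>)\<close> and \<open>H\<^sub>k\<^sub>-\<^sub>1(\<int>)\<close>, so it vanishes for \<open>k \<ge> 2\<close>; lemma \<open>cyclic_acyclic\<close>
  carries out this diagram chase on chains.

  The delicate point is the existence of lifts (lemma \<open>lift_exists\<close>). Because \<open>n = 4m\<close> is permitted, two values that
  are both within \<open>m\<close> of a third may be antipodal, and their difference then has no preferred
  integer representative. The lift therefore has to be pinned down by connectedness, not just by
  comparing nearby values.\<close>


section \<open>Functions that are continuous up to a closeness relation\<close>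

text \<open>Continuity into a closure space whose closure operator comes from a relation \<open>R\<close> on points. The
  neighbourhood filter includes the point itself, which makes \<open>R\<close> reflexive on the values taken and
  lets this notion be pulled back along continuous maps without side conditions.\<close>

definition locally_close ::
    "('b \<Rightarrow> 'b \<Rightarrow> bool) \<Rightarrow> 'a::topological_space set \<Rightarrow> ('a \<Rightarrow> 'b) \<Rightarrow> bool" where
  "locally_close R S f \<longleftrightarrow> (\<forall>x\<in>S. \<forall>\<^sub>F y in nhds x. y \<in> S \<longrightarrow> R (f x) (f y))"

lemma locally_close_compose:
  assumes "locally_close R S f" "continuous_on T g" "g \<in> T \<rightarrow> S"
  shows "locally_close R T (f \<circ> g)"
  unfolding locally_close_def
proof
  fix x assume x: "x \<in> T"
  let ?P = "\<lambda>z. z \<in> S \<longrightarrow> R (f (g x)) (f z)"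
  have ev: "\<forall>\<^sub>F z in nhds (g x). ?P z"
    using assms x by (auto simp: locally_close_def)
  have "(g \<longlongrightarrow> g x) (at x within T)"
    using assms(2) x by (simp add: continuous_on_def)
  then have "\<forall>\<^sub>F y in at x within T. ?P (g y)"
    by (rule eventually_compose_filterlim[OF ev])
  then have "\<forall>\<^sub>F y in nhds x. y \<noteq> x \<longrightarrow> y \<in> T \<longrightarrow> ?P (g y)"
    by (simp add: eventually_at_filter)
  then show "\<forall>\<^sub>F y in nhds x. y \<in> T \<longrightarrow> R ((f \<circ> g) x) ((f \<circ> g) y)"
    using eventually_nhds_x_imp_x[OF ev] assms(3) by (auto elim!: eventually_mono)
qed

lemma locally_close_mono:
  assumes "locally_close R S f" "\<And>i j. R i j \<Longrightarrow> R' (g i) (g j)"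
  shows "locally_close R' S (g \<circ> f)"
  using assms unfolding locally_close_def by (auto elim!: eventually_mono)

lemma locally_close_cong:
  assumes "\<And>x. x \<in> S \<Longrightarrow> f x = g x"
  shows "locally_close R S f \<longleftrightarrow> locally_close R S g"
  unfolding locally_close_def using assms by (auto elim!: eventually_mono)

lemma locally_close_eq_imp_constant:
  assumes "locally_close (=) S f" "connected S" "x \<in> S" "y \<in> S"
  shows "f x = f y"
proof (rule connected_local_const[OF assms(2-4)], rule)
  fix a assume "a \<in> S"
  then show "\<forall>\<^sub>F b in at a within S. f a = f b"
    using assms(1) unfolding locally_close_def eventually_at_filter
    by (auto elim!: eventually_mono dest!: bspec[of _ _ a])
qed

section \<open>Lifting closeness modulo n to the integers\<close>

text \<open>The point \<open>j\<close> lies within distance \<open>m\<close> of \<open>i\<close> around the circle of length \<open>n\<close>.\<close>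

definition cyclically_close :: "int \<Rightarrow> int \<Rightarrow> int \<Rightarrow> int \<Rightarrow> bool" where
  "cyclically_close n m i j \<longleftrightarrow> (\<exists>r. \<bar>r\<bar> \<le> m \<and> [r = j - i] (mod n))"

text \<open>The representative of \<open>a\<close> modulo \<open>n\<close> in the window from \<open>-m\<close> to \<open>n - m - 1\<close>. If \<open>2m < n\<close> and
  \<open>a\<close> is the difference of two close points, it is the signed displacement between them.\<close>

definition offset :: "int \<Rightarrow> int \<Rightarrow> int \<Rightarrow> int" where
  "offset n m a = (a + m) mod n - m"

lemma cong_offset: "[offset n m a = a] (mod n)"
  by (simp add: offset_def cong_def mod_diff_left_eq)

lemma cong_imp_eq_int:
  assumes "[a = b] (mod n)" "\<bar>a - b\<bar> < (n::int)"
  shows "a = b"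
proof (rule ccontr)
  assume "a \<noteq> b"
  then have "\<bar>n\<bar> \<le> \<bar>a - b\<bar>"
    using assms(1) by (intro dvd_imp_le_int) (simp_all add: cong_iff_dvd_diff)
  then show False
    using assms(2) by linarith
qed

lemma offset_eq:
  assumes "\<bar>r\<bar> \<le> m" "[r = a] (mod n)" "2 * m < n"
  shows "offset n m a = r"
proof -
  have "(a + m) mod n = (r + m) mod n"
    using assms(2) by (metis cong_add_rcancel cong_def)
  then show ?thesis
    using assms by (simp add: offset_def)
qed

lemma abs_offset_le:
  assumes "cyclically_close n m i j" "2 * m < n"
  shows "\<bar>offset n m (j - i)\<bar> \<le> m"
  using assms offset_eq unfolding cyclically_close_def by blast

text \<open>Displacements add up along a triangle of mutually close points, since a discrepancy would be a
  multiple of \<open>n\<close> of size at most \<open>3m\<close>.\<close>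

lemma offset_diff:
  assumes "cyclically_close n m c u" "cyclically_close n m c v" "cyclically_close n m u v" "3 * m < n"
  shows "offset n m (v - c) - offset n m (u - c) = offset n m (v - u)"
proof (rule cong_imp_eq_int)
  have "0 \<le> m"
    using assms(1) by (auto simp: cyclically_close_def)
  then have "2 * m < n"
    using assms(4) by simp
  then show "\<bar>offset n m (v - c) - offset n m (u - c) - offset n m (v - u)\<bar> < n"
    using assms abs_offset_le[of n m c u] abs_offset_le[of n m c v] abs_offset_le[of n m u v] by linarith
  have "[offset n m (v - c) - offset n m (u - c) = (v - c) - (u - c)] (mod n)"
    by (intro cong_diff cong_offset)
  then show "[offset n m (v - c) - offset n m (u - c) = offset n m (v - u)] (mod n)"
    using cong_offset[of n m "v - u"] by (simp add: cong_def)
qed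

text \<open>Around a centre \<open>c\<close>, the displacement from \<open>c\<close> lifts \<open>f\<close> up to a constant. For \<open>n = 4m\<close> the
  difference of two such lifts, with centres \<open>c\<close> and \<open>c'\<close>, can take two values; but it is locally
  constant by additivity of displacements, so on a connected set both lifts show the same
  increments.\<close>

lemma offset_diff_centre:
  fixes f :: "'a::topological_space \<Rightarrow> int"
  assumes "locally_close (cyclically_close n m) S f" "connected S" "3 * m < n"
    and "\<And>s. s \<in> S \<Longrightarrow> cyclically_close n m c (f s)"
    and "\<And>s. s \<in> S \<Longrightarrow> cyclically_close n m c' (f s)"
    and "s \<in> S" "t \<in> S"
  shows "offset n m (f t - c) - offset n m (f s - c) = offset n m (f t - c') - offset n m (f s - c')"
proof -
  let ?d = "\<lambda>s. offset n m (f s - c) - offset n m (f s - c')"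
  have "locally_close (=) S ?d"
    unfolding locally_close_def
  proof
    fix x assume x: "x \<in> S"
    have "?d x = ?d y" if "y \<in> S" "cyclically_close n m (f x) (f y)" for y
      using offset_diff[of n m c "f x" "f y"] offset_diff[of n m c' "f x" "f y"] assms x that by fastforce
    moreover have "\<forall>\<^sub>F y in nhds x. y \<in> S \<longrightarrow> cyclically_close n m (f x) (f y)"
      using assms(1) x by (simp add: locally_close_def)
    ultimately show "\<forall>\<^sub>F y in nhds x. y \<in> S \<longrightarrow> ?d x = ?d y"
      by (auto elim!: eventually_mono)
  qed
  from locally_close_eq_imp_constant[OF this assms(2) assms(6,7)] show ?thesis
    by simp
qed

lemma grid_interval_subset:
  assumes "i < N"
  shows "{real i / real N..real (Suc i) / real N} \<subseteq> {0..1}"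
proof -
  have "real (Suc i) / real N \<le> 1" "0 \<le> real i / real N"
    using assms by (simp_all add: divide_le_eq)
  then show ?thesis
    by (meson atLeastAtMost_iff order_trans subsetI)
qed

text \<open>A Lebesgue number argument: the tracks \<open>h y\<close> of a homotopy on a compact set are cut into \<open>N\<close> equal
  pieces so short that each piece, together with the corresponding pieces of all nearby tracks,
  stays close to a single value of \<open>f\<close>.\<close>

lemma uniform_centres:
  fixes f :: "'a::metric_space \<Rightarrow> 'b" and h :: "'a \<Rightarrow> real \<Rightarrow> 'a"
  assumes "compact S" "locally_close R S f"
    and h: "continuous_on (S \<times> {0..1}) (\<lambda>(x, s). h x s)" "\<And>x s. x \<in> S \<Longrightarrow> s \<in> {0..1} \<Longrightarrow> h x s \<in> S"
  obtains N :: nat and d :: real and C where "N > 0" "d > 0"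
    "\<And>x i y s. \<lbrakk>x \<in> S; i < N; y \<in> S; dist y x < d; s \<in> {real i / real N..real (Suc i) / real N}\<rbrakk>
       \<Longrightarrow> R (f (C x i)) (f (h y s))"
proof -
  have "\<exists>U. open U \<and> x \<in> U \<and> (\<forall>y\<in>U. y \<in> S \<longrightarrow> R (f x) (f y))" if "x \<in> S" for x
    using assms(2) that unfolding locally_close_def eventually_nhds by blast
  then obtain U where U: "\<And>x. x \<in> S \<Longrightarrow> open (U x)" "\<And>x. x \<in> S \<Longrightarrow> x \<in> U x"
      "\<And>x y. \<lbrakk>x \<in> S; y \<in> U x; y \<in> S\<rbrakk> \<Longrightarrow> R (f x) (f y)"
    by metis
  obtain e where e: "e > 0" "\<And>x. x \<in> S \<Longrightarrow> \<exists>c\<in>S. ball x e \<subseteq> U c"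
  proof (rule Heine_Borel_lemma[OF assms(1), of "U ` S"])
    show "S \<subseteq> \<Union> (U ` S)"
      using U(2) by blast
  qed (use U(1) in \<open>auto intro: that\<close>)
  have "uniformly_continuous_on (S \<times> {0..1}) (\<lambda>(x, s). h x s)"
    using h(1) assms(1) by (intro compact_uniformly_continuous compact_Times) auto
  then obtain d where d: "d > 0"
    "\<And>p q. \<lbrakk>p \<in> S \<times> {0..1}; q \<in> S \<times> {0..1}; dist q p < d\<rbrakk>
       \<Longrightarrow> dist (case q of (x, s) \<Rightarrow> h x s) (case p of (x, s) \<Rightarrow> h x s) < e"
    using uniformly_continuous_onE[of "S \<times> {0..1}" "\<lambda>(x, s). h x s" "e"] e(1) by auto
  have hd: "dist (h y t) (h x s) < e"
    if "x \<in> S" "y \<in> S" "s \<in> {0..1}" "t \<in> {0..1}" "dist y x < d / 2" "dist t s < d / 2" for x y s t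
  proof -
    have "dist (y, t) (x, s) \<le> dist y x + dist t s"
      unfolding dist_Pair_Pair by (rule sqrt_sum_squares_le_sum) auto
    then show ?thesis
      using d(2)[of "(x, s)" "(y, t)"] that by auto
  qed
  obtain N :: nat where N: "N > 0" "1 / real N < d / 2"
    using d(1) by (metis half_gt_zero nat_approx_posE zero_less_Suc)
  have "\<exists>c. \<forall>y\<in>S. \<forall>s\<in>{real i / real N..real (Suc i) / real N}. dist y x < d / 2 \<longrightarrow> R (f c) (f (h y s))"
    if "x \<in> S" "i < N" for x i
  proof -
    let ?I = "{real i / real N..real (Suc i) / real N}"
    note I = grid_interval_subset[OF that(2)]
    have i01: "real i / real N \<in> {0..1}"
      using that(2) by (simp add: divide_le_eq)
    then obtain c where c: "c \<in> S" "ball (h x (real i / real N)) e \<subseteq> U c"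
      using e(2)[OF h(2)[OF \<open>x \<in> S\<close>]] by blast
    have "R (f c) (f (h y s))" if y: "y \<in> S" "dist y x < d / 2" and s: "s \<in> ?I" for y s
    proof -
      have "real (Suc i) / real N = real i / real N + 1 / real N"
        by (simp add: add_divide_distrib)
      then have "dist s (real i / real N) < d / 2"
        using s N(2) unfolding dist_real_def atLeastAtMost_iff by linarith
      moreover have "s \<in> {0..1}"
        using I s by blast
      ultimately have "h y s \<in> ball (h x (real i / real N)) e"
        using hd[OF \<open>x \<in> S\<close> y(1) i01 _ y(2)] by (simp add: dist_commute)
      then show ?thesis
        using c U(3) h(2)[OF y(1) \<open>s \<in> {0..1}\<close>] by blast
    qed
    then show ?thesis
      by blast
  qed
  then obtain C where "\<And>x i y s. \<lbrakk>x \<in> S; i < N; y \<in> S; dist y x < d / 2;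
      s \<in> {real i / real N..real (Suc i) / real N}\<rbrakk> \<Longrightarrow> R (f (C x i)) (f (h y s))"
    by metis
  with N(1) d(1) show thesis
    by (intro that[of N "d / 2" C]) auto
qed

text \<open>The lift at \<open>x\<close> is \<open>f a\<close> plus the total displacement of \<open>f\<close> along the track from \<open>a\<close> to \<open>x\<close>,
  added up over short pieces. Comparing \<open>x\<close> with a nearby \<open>y\<close>, the increments over corresponding
  pieces differ by the displacements between the two tracks at the end points of the piece. The sum
  of these differences telescopes to the displacement from \<open>f x\<close> to \<open>f y\<close>, because both tracks start
  at \<open>a\<close>, and it is therefore at most \<open>m\<close>.\<close>

lemma lift_exists:
  fixes f :: "'a::metric_space \<Rightarrow> int" and h :: "'a \<Rightarrow> real \<Rightarrow> 'a"
  assumes "compact S" and close: "locally_close (cyclically_close n m) S f" and "3 * m < n"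
    and h: "continuous_on (S \<times> {0..1}) (\<lambda>(x, s). h x s)" "\<And>x s. x \<in> S \<Longrightarrow> s \<in> {0..1} \<Longrightarrow> h x s \<in> S"
      "\<And>x. x \<in> S \<Longrightarrow> h x 0 = a" "\<And>x. x \<in> S \<Longrightarrow> h x 1 = x"
  obtains L where "locally_close (\<lambda>i j. \<bar>j - i\<bar> \<le> m) S L" "\<And>x. x \<in> S \<Longrightarrow> [L x = f x] (mod n)"
proof -
  obtain N d C where N: "N > 0" "d > 0" and C:
    "\<And>x i y s. \<lbrakk>x \<in> S; i < N; y \<in> S; dist y x < d; s \<in> {real i / real N..real (Suc i) / real N}\<rbrakk>
       \<Longrightarrow> cyclically_close n m (f (C x i)) (f (h y s))"
    using uniform_centres[OF assms(1) close h(1,2)] by blast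
  define g where "g x i = f (h x (real i / real N))" for x i
  define L where "L x = f a + (\<Sum>i<N. offset n m (g x (Suc i) - f (C x i)) - offset n m (g x i - f (C x i)))" for x
  have g0: "g x 0 = f a" and gN: "g x N = f x" if "x \<in> S" for x
    using that N(1) h(3,4) by (simp_all add: g_def)
  have "[L x = f x] (mod n)" if x: "x \<in> S" for x
  proof -
    have "[L x = f a + (\<Sum>i<N. (g x (Suc i) - f (C x i)) - (g x i - f (C x i)))] (mod n)"
      unfolding L_def by (intro cong_add cong_sum cong_diff cong_offset cong_refl)
    also have "(\<Sum>i<N. (g x (Suc i) - f (C x i)) - (g x i - f (C x i))) = g x N - g x 0"
      by (simp add: sum_lessThan_telescope)
    finally show ?thesis
      using x by (simp add: g0 gN)
  qed
  moreover have "locally_close (\<lambda>i j. \<bar>j - i\<bar> \<le> m) S L"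
    unfolding locally_close_def
  proof
    fix x assume x: "x \<in> S"
    then have "\<forall>\<^sub>F y in nhds x. y \<in> S \<longrightarrow> cyclically_close n m (f x) (f y)"
      using close by (simp add: locally_close_def)
    from eventually_nhds_x_imp_x[OF this] have m: "0 \<le> m"
      using x by (auto simp: cyclically_close_def)
    have "continuous_on S (\<lambda>y. h y (real i / real N))" if "i \<le> N" for i
    proof -
      have "continuous_on S (\<lambda>y. (y, real i / real N))"
        by (intro continuous_intros)
      moreover have "(\<lambda>y. (y, real i / real N)) ` S \<subseteq> S \<times> {0..1}"
        using that N(1) by (auto simp: divide_le_eq)
      ultimately show ?thesis
        using continuous_on_compose2[OF h(1), of S "\<lambda>y. (y, real i / real N)"] by simp
    qed
    moreover have "(\<lambda>y. h y (real i / real N)) \<in> S \<rightarrow> S" if "i \<le> N" for i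
      using that N(1) h(2) by (auto simp: divide_le_eq)
    ultimately have "locally_close (cyclically_close n m) S (\<lambda>y. g y i)" if "i \<le> N" for i
      using locally_close_compose[OF close, of S "\<lambda>y. h y (real i / real N)"] that by (simp add: g_def comp_def)
    then have "\<forall>\<^sub>F y in nhds x. \<forall>i\<in>{..N}. y \<in> S \<longrightarrow> cyclically_close n m (g x i) (g y i)"
      using x by (intro eventually_ball_finite) (auto simp: locally_close_def)
    moreover have "\<forall>\<^sub>F y in nhds x. dist y x < d"
      using N(2) eventually_nhds_metric by blast
    ultimately show "\<forall>\<^sub>F y in nhds x. y \<in> S \<longrightarrow> \<bar>L y - L x\<bar> \<le> m"
    proof eventually_elim
      case (elim y)
      show ?case
      proof
        assume y: "y \<in> S"
        then have xy: "cyclically_close n m (g x i) (g y i)" if "i \<le> N" for i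
          using elim that by blast
        \<comment> \<open>The increment for \<open>y\<close> may be computed with the centre chosen for \<open>x\<close>, so that
          additivity of displacements applies at both ends of the piece.\<close>
        have step: "(offset n m (g y (Suc i) - f (C y i)) - offset n m (g y i - f (C y i)))
              - (offset n m (g x (Suc i) - f (C x i)) - offset n m (g x i - f (C x i)))
            = offset n m (g y (Suc i) - g x (Suc i)) - offset n m (g y i - g x i)" if i: "i < N" for i
        proof -
          let ?I = "{real i / real N..real (Suc i) / real N}"
          have ends: "real i / real N \<in> ?I" "real (Suc i) / real N \<in> ?I"
            by (auto simp: divide_right_mono)
          note I = grid_interval_subset[OF i]
          have "continuous_on ?I (h y)"
          proof -
            have "continuous_on ?I (\<lambda>s. (y, s))"
              by (intro continuous_intros)
            moreover have "(\<lambda>s. (y, s)) ` ?I \<subseteq> S \<times> {0..1}"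
              using y I by blast
            ultimately show ?thesis
              using continuous_on_compose2[OF h(1), of ?I "\<lambda>s. (y, s)"] by simp
          qed
          then have "locally_close (cyclically_close n m) ?I (\<lambda>s. f (h y s))"
          proof -
            have "h y \<in> ?I \<rightarrow> S"
              using h(2) y I by blast
            with \<open>continuous_on ?I (h y)\<close> show ?thesis
              using locally_close_compose[OF close, of ?I "h y"] by (simp add: comp_def)
          qed
          moreover have "cyclically_close n m (f (C y i)) (f (h y s))" "cyclically_close n m (f (C x i)) (f (h y s))"
            if "s \<in> ?I" for s
            using C[OF y i y] C[OF x i y] that elim(2) N(2) by simp_all
          ultimately have "offset n m (g y (Suc i) - f (C y i)) - offset n m (g y i - f (C y i))
              = offset n m (g y (Suc i) - f (C x i)) - offset n m (g y i - f (C x i))"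
            unfolding g_def using offset_diff_centre[OF _ connected_Icc assms(3)] ends by blast
          moreover have "offset n m (g y j - f (C x i)) - offset n m (g x j - f (C x i)) = offset n m (g y j - g x j)"
            if "j = i \<or> j = Suc i" for j
          proof (rule offset_diff[OF _ _ _ assms(3)])
            have "real j / real N \<in> ?I"
              using that ends by blast
            then show "cyclically_close n m (f (C x i)) (g x j)" "cyclically_close n m (f (C x i)) (g y j)"
              unfolding g_def using C x y i elim(2) N(2) dist_self by metis+
            show "cyclically_close n m (g x j) (g y j)"
              using xy that i by auto
          qed
          \<comment> \<open>Subtract the comparison of the two tracks at the start of the piece from that at its end.\<close>
          from this[of i] this[of "Suc i"] calculation show ?thesis
            by simp
        qed
        have "L y - L x = (\<Sum>i<N. (offset n m (g y (Suc i) - f (C y i)) - offset n m (g y i - f (C y i)))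
              - (offset n m (g x (Suc i) - f (C x i)) - offset n m (g x i - f (C x i))))"
          by (simp add: L_def sum_subtractf)
        also have "\<dots> = (\<Sum>i<N. offset n m (g y (Suc i) - g x (Suc i)) - offset n m (g y i - g x i))"
          using step by (intro sum.cong) auto
        also have "\<dots> = offset n m (g y N - g x N) - offset n m (g y 0 - g x 0)"
          by (rule sum_lessThan_telescope)
        also have "offset n m (g y 0 - g x 0) = 0"
          using m assms(3) x y by (simp add: g0 offset_eq)
        finally show "\<bar>L y - L x\<bar> \<le> m"
          using abs_offset_le[OF xy[of N]] m assms(3) by simp
      qed
    qed
  qed
  ultimately show thesis
    using that by blast
qed

section \<open>Singular chains of close simplices\<close>

definition close_simplices :: "('b \<Rightarrow> 'b \<Rightarrow> bool) \<Rightarrow> 'b set \<Rightarrow> nat \<Rightarrow> ((nat \<Rightarrow> real) \<Rightarrow> 'b) set" where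
  "close_simplices R X p =
     {f \<in> standard_simplex p \<rightarrow>\<^sub>E X. locally_close R (standard_simplex p) f}"

text \<open>For a closure operator that is generated by a relation on points, continuity of a map only has to
  be tested on the sets of points whose values are not related to a given one.\<close>

lemma closure_singular_simplices_eq_close_simplices:
  assumes c: "\<And>A. A \<subseteq> X \<Longrightarrow> c A = {x \<in> X. \<exists>y\<in>A. R x y}"
  shows "{f. closure_singular_simplex p X c f} = close_simplices R X p"
proof -
  let ?S = "standard_simplex p"
  have clos: "(subtopology (powertop_real UNIV) ?S) closure_of A = ?S \<inter> closure A" if "A \<subseteq> ?S" for A
    using that by (simp add: closure_of_subtopology euclidean_product_topology Int_absorb1)
  have "(\<forall>A. A \<subseteq> ?S \<longrightarrow> f ` (subtopology (powertop_real UNIV) ?S closure_of A) \<subseteq> c (f ` A))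
      \<longleftrightarrow> locally_close R ?S f" if f: "f \<in> ?S \<rightarrow> X" for f
  proof
    assume cont: "\<forall>A. A \<subseteq> ?S \<longrightarrow> f ` (subtopology (powertop_real UNIV) ?S closure_of A) \<subseteq> c (f ` A)"
    show "locally_close R ?S f"
      unfolding locally_close_def
    proof
      fix x assume x: "x \<in> ?S"
      let ?A = "{y \<in> ?S. \<not> R (f x) (f y)}"
      have "f x \<notin> c (f ` ?A)"
        using f by (subst c) auto
      moreover have "f ` (?S \<inter> closure ?A) \<subseteq> c (f ` ?A)"
        using cont clos[of ?A] by (metis (no_types, lifting) mem_Collect_eq subsetI)
      ultimately have "x \<notin> closure ?A"
        using x by blast
      then have "\<forall>\<^sub>F y in nhds x. y \<in> - closure ?A"
        by (intro eventually_nhds_in_open) auto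
      then show "\<forall>\<^sub>F y in nhds x. y \<in> ?S \<longrightarrow> R (f x) (f y)"
        using closure_subset[of ?A] by (auto elim!: eventually_mono)
    qed
  next
    assume close: "locally_close R ?S f"
    show "\<forall>A. A \<subseteq> ?S \<longrightarrow> f ` (subtopology (powertop_real UNIV) ?S closure_of A) \<subseteq> c (f ` A)"
    proof (intro allI impI image_subsetI)
      fix A x assume A: "A \<subseteq> ?S" and "x \<in> subtopology (powertop_real UNIV) ?S closure_of A"
      then have x: "x \<in> ?S" "x \<in> closure A"
        using clos by auto
      then obtain U where U: "open U" "x \<in> U" "\<forall>y\<in>U. y \<in> ?S \<longrightarrow> R (f x) (f y)"
        using close unfolding locally_close_def eventually_nhds by blast
      then have "U \<inter> A \<noteq> {}"
        using x(2) open_Int_closure_eq_empty[of U A] by blast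
      then obtain y where "y \<in> U" "y \<in> A"
        by blast
      moreover have "f ` A \<subseteq> X"
        using f A by blast
      ultimately show "f x \<in> c (f ` A)"
        using c U(3) A x(1) f by blast
    qed
  qed
  then show ?thesis
    by (auto simp: closure_singular_simplex_def closure_continuous_def close_simplices_def PiE_def)
qed

lemma close_simplices_mapsto: "f \<in> close_simplices R X p \<Longrightarrow> x \<in> standard_simplex p \<Longrightarrow> f x \<in> X"
  by (auto simp: close_simplices_def)

lemma close_simplices_extensional: "f \<in> close_simplices R X p \<Longrightarrow> f \<in> extensional (standard_simplex p)"
  by (auto simp: close_simplices_def PiE_def)

lemma restrict_in_close_simplices:
  "restrict f (standard_simplex p) \<in> close_simplices R X p \<longleftrightarrow>
     f \<in> standard_simplex p \<rightarrow> X \<and> locally_close R (standard_simplex p) f"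
  using locally_close_cong[of "standard_simplex p" "restrict f (standard_simplex p)" f R]
  by (auto simp: close_simplices_def)

lemma singular_face_in_close_simplices:
  assumes "f \<in> close_simplices R X p" "1 \<le> p" "k \<le> p"
  shows "singular_face p k f \<in> close_simplices R X (p - 1)"
proof -
  have into: "simplical_face k \<in> standard_simplex (p - 1) \<rightarrow> standard_simplex p"
    using assms simplical_face_in_standard_simplex by auto
  have "continuous_on (standard_simplex (p - 1)) (\<lambda>x. if i < k then x i else if i = k then 0 else x (i - 1) :: real)" for i
    by (cases "i < k"; cases "i = k") (simp_all add: continuous_on_subset[OF continuous_on_product_coordinates])
  then have "continuous_on (standard_simplex (p - 1)) (simplical_face k :: (nat \<Rightarrow> real) \<Rightarrow> _)"
    by (intro continuous_on_coordinatewise_then_product) (simp add: simplical_face_def)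
  with into have "locally_close R (standard_simplex (p - 1)) (f \<circ> simplical_face k)"
    using assms(1) by (intro locally_close_compose) (auto simp: close_simplices_def)
  moreover have "f \<circ> simplical_face k \<in> standard_simplex (p - 1) \<rightarrow> X"
    using into close_simplices_mapsto[OF assms(1)] by (auto simp: Pi_iff)
  ultimately show ?thesis
    unfolding singular_face_def One_nat_def[symmetric] restrict_in_close_simplices by blast
qed

lemma simplex_map_in_close_simplices:
  assumes "f \<in> close_simplices R X p" "\<And>i. i \<in> X \<Longrightarrow> g i \<in> Y" "\<And>i j. R i j \<Longrightarrow> R' (g i) (g j)"
  shows "simplex_map p g f \<in> close_simplices R' Y p"
proof -
  have "g \<circ> f \<in> standard_simplex p \<rightarrow> Y"
    using assms(2) close_simplices_mapsto[OF assms(1)] by auto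
  moreover have "locally_close R' (standard_simplex p) (g \<circ> f)"
    using assms(1,3) by (intro locally_close_mono[of R]) (auto simp: close_simplices_def)
  ultimately show ?thesis
    by (simp add: simplex_map_def restrict_in_close_simplices)
qed

lemma chain_boundary_keys:
  assumes "Poly_Mapping.keys c \<subseteq> close_simplices R X p"
  shows "Poly_Mapping.keys (chain_boundary p c) \<subseteq> close_simplices R X (p - 1)"
proof (cases "p = 0")
  case False
  then have "Poly_Mapping.keys (\<Sum>k\<le>p. frag_cmul ((-1) ^ k) (frag_of (singular_face p k f))) \<subseteq> close_simplices R X (p - 1)"
    if "f \<in> close_simplices R X p" for f
    using that by (intro order_trans[OF keys_sum] UN_least order_trans[OF keys_cmul])
      (use False in \<open>auto intro: singular_face_in_close_simplices[simplified]\<close>)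
  then show ?thesis
    using assms False by (auto simp: chain_boundary_def dest!: set_mp[OF keys_frag_extend])
qed (simp add: chain_boundary_def)

lemma chain_map_keys:
  assumes "Poly_Mapping.keys c \<subseteq> S" "\<And>f. f \<in> S \<Longrightarrow> simplex_map p g f \<in> T"
  shows "Poly_Mapping.keys (chain_map p g c) \<subseteq> T"
  using assms by (auto simp: chain_map_def dest!: set_mp[OF keys_frag_extend])

text \<open>Boundaries and chain maps do not depend on any structure of the target. Every chain is a singular
  chain for the indiscrete topology, here the pullback of the topology of the reals along a constant
  map, and so the chain identities for topological targets carry over to closure spaces.\<close>

lemma singular_chain_indiscrete:
  assumes "Poly_Mapping.keys c \<subseteq> extensional (standard_simplex p)"
  shows "singular_chain p (pullback_topology UNIV (\<lambda>_. 0::real) euclidean) c"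
proof -
  have "continuous_map T (pullback_topology UNIV (\<lambda>_. 0::real) euclidean) f" for T :: "'c topology" and f :: "'c \<Rightarrow> 'b"
    by (rule continuous_map_pullback') (auto simp: comp_def)
  then show ?thesis
    using assms unfolding singular_chain_def singular_simplex_def by blast
qed

lemma chain_boundary_boundary_extensional:
  assumes "Poly_Mapping.keys c \<subseteq> extensional (standard_simplex (Suc p))"
  shows "chain_boundary p (chain_boundary (Suc p) c) = 0"
  using chain_boundary_boundary_alt[OF singular_chain_indiscrete] assms by blast

lemma chain_boundary_chain_map_extensional:
  assumes "Poly_Mapping.keys c \<subseteq> extensional (standard_simplex p)"
  shows "chain_boundary p (chain_map p g c) = chain_map (p - 1) g (chain_boundary p c)"
  using chain_boundary_chain_map[OF singular_chain_indiscrete] assms by (metis One_nat_def)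

lemma trivial_group_subgroup_generated_Mod:
  assumes "group G" "subgroup H G"
  shows "trivial_group (subgroup_generated G H Mod H)"
proof -
  let ?K = "subgroup_generated G H"
  have carrier: "carrier ?K = H"
    using assms by (simp add: subgroup.carrier_subgroup_generated_subgroup)
  interpret K: group ?K
    using assms(1) by (rule group.group_subgroup_generated)
  have "H \<lhd> ?K"
    using K.normal_self carrier by simp
  then interpret F: group "?K Mod H"
    by (rule normal.factorgroup_is_group)
  have "carrier (?K Mod H) \<subseteq> {\<one>\<^bsub>?K Mod H\<^esub>}"
    using carrier K.coset_join2[OF _ K.subgroup_self] by (auto simp: carrier_FactGroup)
  then show ?thesis
    using F.trivial_group_subset by blast
qed

text \<open>Boundaries are cycles because \<open>\<partial>\<partial> = 0\<close>, so exactness at one place turns the homology group into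
  the quotient of the group of cycles by itself.\<close>

lemma trivial_closure_homology_group:
  assumes simplices: "\<And>q. {f. closure_singular_simplex q X c f} = close_simplices R X q"
    and exact: "\<And>z. \<lbrakk>Poly_Mapping.keys z \<subseteq> close_simplices R X p; chain_boundary p z = 0\<rbrakk>
      \<Longrightarrow> \<exists>w. Poly_Mapping.keys w \<subseteq> close_simplices R X (Suc p) \<and> chain_boundary (Suc p) w = z"
  shows "trivial_group (closure_homology_group p X c)"
proof -
  have carrier: "carrier (closure_chain_group q X c) = {z. Poly_Mapping.keys z \<subseteq> close_simplices R X q}" for q
    by (auto simp: closure_chain_group_def simplices)
  let ?C = "closure_chain_group p X c" and ?D = "closure_chain_group (p - 1) X c"
  let ?Z = "kernel ?C ?D (chain_boundary p)"
  have group: "group (closure_chain_group q X c)" for q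
    by (simp add: closure_chain_group_def)
  have hom: "chain_boundary p \<in> hom ?C ?D"
    using chain_boundary_keys[of _ R X p]
    by (auto simp: hom_def carrier) (simp add: closure_chain_group_def chain_boundary_add)
  then have "subgroup ?Z ?C"
    using group by (intro group_hom.subgroup_kernel) (simp add: group_hom_def group_hom_axioms_def)
  moreover have "chain_boundary (Suc p) ` carrier (closure_chain_group (Suc p) X c) = ?Z"
  proof -
    have "chain_boundary p (chain_boundary (Suc p) w) = 0"
      if "Poly_Mapping.keys w \<subseteq> close_simplices R X (Suc p)" for w
      using that by (intro chain_boundary_boundary_extensional) (auto dest: close_simplices_extensional)
    moreover have Z: "z \<in> ?Z \<longleftrightarrow> Poly_Mapping.keys z \<subseteq> close_simplices R X p \<and> chain_boundary p z = 0" for z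
      unfolding kernel_def carrier by (simp add: closure_chain_group_def)
    moreover have "Poly_Mapping.keys (chain_boundary (Suc p) w) \<subseteq> close_simplices R X p"
      if "Poly_Mapping.keys w \<subseteq> close_simplices R X (Suc p)" for w
      using chain_boundary_keys[OF that] by simp
    ultimately have "chain_boundary (Suc p) ` carrier (closure_chain_group (Suc p) X c) \<subseteq> ?Z"
      unfolding carrier by (intro image_subsetI) simp
    moreover have "z \<in> chain_boundary (Suc p) ` carrier (closure_chain_group (Suc p) X c)" if "z \<in> ?Z" for z
    proof -
      have "Poly_Mapping.keys z \<subseteq> close_simplices R X p" "chain_boundary p z = 0"
        using that Z[of z] by simp_all
      from exact[OF this] show ?thesis
        unfolding carrier by blast
    qed
    ultimately show ?thesis
      by (intro equalityI subsetI) auto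
  qed
  ultimately show ?thesis
    using trivial_group_subgroup_generated_Mod[OF group] by (simp add: closure_homology_group_def)
qed

section \<open>Acyclicity of the integers\<close>

text \<open>A cone operator \<open>K\<close>, which adds a new first vertex to every simplex and commutes with the
  remaining faces, satisfies \<open>\<partial>K + K\<partial> = 1\<close> in positive degrees. So \<open>K z\<close> bounds each cycle \<open>z\<close>.\<close>

lemma cone_operator_acyclic:
  fixes S :: "nat \<Rightarrow> ((nat \<Rightarrow> real) \<Rightarrow> 'b) set"
  assumes "1 \<le> p" "Poly_Mapping.keys z \<subseteq> S p" "chain_boundary p z = 0"
    and K: "\<And>\<sigma>. \<sigma> \<in> S p \<Longrightarrow> K p \<sigma> \<in> S (Suc p)"
    and face0: "\<And>\<sigma>. \<sigma> \<in> S p \<Longrightarrow> singular_face (Suc p) 0 (K p \<sigma>) = \<sigma>"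
    and face: "\<And>\<sigma> k. \<lbrakk>\<sigma> \<in> S p; k \<le> p\<rbrakk> \<Longrightarrow>
      singular_face (Suc p) (Suc k) (K p \<sigma>) = K (p - 1) (singular_face p k \<sigma>)"
  shows "\<exists>w. Poly_Mapping.keys w \<subseteq> S (Suc p) \<and> chain_boundary (Suc p) w = z"
proof (intro exI conjI)
  let ?K = "\<lambda>p. frag_extend (frag_of \<circ> K p)"
  show "Poly_Mapping.keys (?K p z) \<subseteq> S (Suc p)"
    using assms(2) K by (auto dest!: set_mp[OF keys_frag_extend])
  have "chain_boundary (Suc p) (?K p z) = z - ?K (p - 1) (chain_boundary p z)"
    using assms(2)
  proof (induction z rule: frag_induction)
    case (one \<sigma>)
    have "chain_boundary (Suc p) (frag_of (K p \<sigma>))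
        = frag_of \<sigma> + (\<Sum>k\<le>p. frag_cmul ((-1) ^ Suc k) (frag_of (K (p - 1) (singular_face p k \<sigma>))))"
      unfolding chain_boundary_of using face0[OF one] face[OF one]
      by (simp add: sum.atMost_Suc_shift del: sum.atMost_Suc)
    also have "\<dots> = frag_of \<sigma> - ?K (p - 1) (chain_boundary p (frag_of \<sigma>))"
      using assms(1) by (simp add: chain_boundary_of frag_extend_sum frag_extend_cmul sum_negf sum_negf
          del: minus_frag_cmul flip: minus_frag_cmul)
    finally show ?case
      by (simp add: comp_def)
  qed (auto simp: chain_boundary_diff frag_extend_diff)
  then show "chain_boundary (Suc p) (?K p z) = z"
    using assms(3) by simp
qed

text \<open>The contraction of the integers at time \<open>u\<close>: clamp to the interval from \<open>-s\<close> to \<open>s\<close>, where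
  \<open>s = \<lfloor>1 / u\<rfloor> - 1\<close>. As \<open>u\<close> grows from 0 to 1, the bound \<open>s\<close> descends from infinity in
  unit steps and is 0 from \<open>u > 1 / 2\<close> on.\<close>

definition shrink :: "real \<Rightarrow> int \<Rightarrow> int" where
  "shrink u i = (if u = 0 then i else max (- (\<lfloor>1 / u\<rfloor> - 1)) (min (\<lfloor>1 / u\<rfloor> - 1) i))"

lemma shrink_0 [simp]: "shrink 0 i = i"
  by (simp add: shrink_def)

lemma shrink_late:
  assumes "1 / 2 < u" "u \<le> 1"
  shows "shrink u i = 0"
proof -
  have "\<lfloor>1 / u\<rfloor> = 1"
    using assms by (intro floor_unique) (auto simp: field_simps)
  then show ?thesis
    using assms by (simp add: shrink_def)
qed

lemma shrink_early:
  assumes "0 \<le> u" "u * (\<bar>real_of_int i\<bar> + 1) < 1"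
  shows "shrink u i = i"
proof (cases "u = 0")
  case False
  then have "\<bar>real_of_int i\<bar> + 1 < 1 / u"
    using assms by (simp add: field_simps)
  then have "\<bar>i\<bar> + 1 \<le> \<lfloor>1 / u\<rfloor>"
    by (simp add: le_floor_iff)
  then show ?thesis
    by (auto simp: shrink_def max_def min_def)
qed simp

text \<open>Clamping is 1-Lipschitz in the value and in the bound jointly, for the maximum metric. The bound
  moves in steps of 1, which is harmless exactly because \<open>m \<ge> 1\<close>.\<close>

lemma shrink_close:
  assumes "u \<noteq> 0" "v \<noteq> 0" "\<bar>1 / v - 1 / u\<bar> < 1" "\<bar>j - i\<bar> \<le> m" "1 \<le> m"
  shows "\<bar>shrink v j - shrink u i\<bar> \<le> m"
proof -
  have "\<bar>\<lfloor>1 / v\<rfloor> - \<lfloor>1 / u\<rfloor>\<bar> \<le> 1"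
    using assms(3) by linarith
  then show ?thesis
    using assms unfolding shrink_def max_def min_def by auto
qed

text \<open>The cone over \<open>\<sigma>\<close> with apex 0: in barycentric coordinates, \<open>t 0\<close> is the time of the contraction
  and the remaining coordinates, rescaled, give the point on the base. At the apex itself the
  rescaling divides by 0 and \<open>\<sigma>\<close> is evaluated outside its simplex, but \<open>shrink 1\<close> is constantly 0.\<close>

definition integer_cone :: "nat \<Rightarrow> ((nat \<Rightarrow> real) \<Rightarrow> int) \<Rightarrow> (nat \<Rightarrow> real) \<Rightarrow> int" where
  "integer_cone p \<sigma> =
     restrict (\<lambda>t. shrink (t 0) (\<sigma> (\<lambda>i. t (Suc i) / (1 - t 0)))) (standard_simplex (Suc p))"

lemma radial_projection_in_simplex:
  assumes "t \<in> standard_simplex (Suc p)" "t 0 \<noteq> 1"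
  shows "(\<lambda>i. t (Suc i) / (1 - t 0)) \<in> standard_simplex p"
proof -
  have t: "\<And>i. 0 \<le> t i \<and> t i \<le> 1" "\<And>i. i > Suc p \<Longrightarrow> t i = 0" "t 0 + (\<Sum>i\<le>p. t (Suc i)) = 1"
    using assms(1) by (auto simp: standard_simplex_def sum.atMost_Suc_shift simp del: sum.atMost_Suc)
  then have pos: "0 < 1 - t 0"
    using assms(2) by (simp add: less_le)
  have le: "t (Suc i) \<le> 1 - t 0" for i
  proof (cases "i \<le> p")
    case True
    then have "t (Suc i) \<le> (\<Sum>i\<le>p. t (Suc i))"
      using t(1) by (intro member_le_sum) auto
    then show ?thesis
      using t(3) by simp
  qed (use t(2) pos in auto)
  have "(\<Sum>i\<le>p. t (Suc i) / (1 - t 0)) = 1"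
    using t(3) pos by (simp flip: sum_divide_distrib)
  then show ?thesis
    using t(1,2) le pos by (auto simp: standard_simplex_def)
qed

text \<open>Continuity is checked separately near the apex, where the cone is locally 0; near the base
  \<open>t 0 = 0\<close>, where the bound of the clamping exceeds all values of \<open>\<sigma>\<close> that occur nearby, so that
  the cone equals \<open>\<sigma>\<close> after projection; and in between, where base point and bound both vary.\<close>

lemma integer_cone_in_close_simplices:
  assumes \<sigma>: "\<sigma> \<in> close_simplices (\<lambda>i j. \<bar>j - i\<bar> \<le> m) UNIV p" and "1 \<le> m"
  shows "integer_cone p \<sigma> \<in> close_simplices (\<lambda>i j. \<bar>j - i\<bar> \<le> m) UNIV (Suc p)"
proof -
  let ?D = "standard_simplex (Suc p)" and ?q = "\<lambda>t i. t (Suc i) / (1 - t 0)"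
  let ?f = "\<lambda>t. shrink (t 0) (\<sigma> (?q t))"
  have "\<forall>\<^sub>F y in nhds t. y \<in> ?D \<longrightarrow> \<bar>?f y - ?f t\<bar> \<le> m" if t: "t \<in> ?D" for t :: "nat \<Rightarrow> real"
  proof -
    have bounds: "0 \<le> y 0" "y 0 \<le> 1" if "y \<in> ?D" for y
      using that by (auto simp: standard_simplex_def)
    have coord: "((\<lambda>y. y 0) \<longlongrightarrow> t 0) (nhds t)"
    proof -
      have "continuous_on UNIV (\<lambda>y :: nat \<Rightarrow> real. y 0)"
        by simp
      then show ?thesis
        unfolding continuous_on_def by (metis UNIV_I tendsto_at_iff_tendsto_nhds)
    qed
    show ?thesis
    proof (cases "t 0 = 1")
      case True
      have "\<forall>\<^sub>F y in nhds t. 1 / 2 < y 0"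
        using coord True by (intro order_tendstoD(1)) auto
      then show ?thesis
        using True bounds \<open>1 \<le> m\<close> by (auto elim!: eventually_mono simp: shrink_late)
    next
      case False
      let ?T = "{y \<in> ?D. y 0 \<noteq> 1}"
      have "continuous_on ?T ?q"
        by (intro continuous_on_coordinatewise_then_product continuous_intros
            continuous_on_subset[OF continuous_on_product_coordinates]) auto
      moreover have "?q \<in> ?T \<rightarrow> standard_simplex p"
        using radial_projection_in_simplex by auto
      ultimately have "locally_close (\<lambda>i j. \<bar>j - i\<bar> \<le> m) ?T (\<sigma> \<circ> ?q)"
        using \<sigma> by (intro locally_close_compose) (auto simp: close_simplices_def)
      then have base: "\<forall>\<^sub>F y in nhds t. y \<in> ?T \<longrightarrow> \<bar>\<sigma> (?q y) - \<sigma> (?q t)\<bar> \<le> m"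
        using t False by (simp add: locally_close_def)
      have away: "\<forall>\<^sub>F y in nhds t. y 0 < 1"
        using coord False bounds[OF t] by (intro order_tendstoD(2)) auto
      show ?thesis
      proof (cases "t 0 = 0")
        case True
        have "((\<lambda>y. y 0 * (\<bar>real_of_int (\<sigma> (?q t))\<bar> + m + 1)) \<longlongrightarrow> 0 * (\<bar>real_of_int (\<sigma> (?q t))\<bar> + m + 1)) (nhds t)"
          using coord True by (intro tendsto_intros) simp
        then have "\<forall>\<^sub>F y in nhds t. y 0 * (\<bar>real_of_int (\<sigma> (?q t))\<bar> + m + 1) < 1"
          by (rule order_tendstoD(2)) simp
        with base away show ?thesis
        proof eventually_elim
          case (elim y)
          show ?case
          proof
            assume y: "y \<in> ?D"
            then have close: "\<bar>\<sigma> (?q y) - \<sigma> (?q t)\<bar> \<le> m"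
              using elim by auto
            then have "\<bar>real_of_int (\<sigma> (?q y))\<bar> + 1 \<le> \<bar>real_of_int (\<sigma> (?q t))\<bar> + m + 1"
              by linarith
            from mult_left_mono[OF this bounds(1)[OF y]] elim(3)
            have "y 0 * (\<bar>real_of_int (\<sigma> (?q y))\<bar> + 1) < 1"
              by linarith
            then show "\<bar>?f y - ?f t\<bar> \<le> m"
              using close True shrink_early[OF bounds(1)[OF y]] by simp
          qed
        qed
      next
        case pos: False
        have "((\<lambda>y. \<bar>1 / y 0 - 1 / t 0\<bar>) \<longlongrightarrow> \<bar>1 / t 0 - 1 / t 0\<bar>) (nhds t)"
          using coord pos by (intro tendsto_intros)
        then have "\<forall>\<^sub>F y in nhds t. \<bar>1 / y 0 - 1 / t 0\<bar> < 1"
          by (rule order_tendstoD(2)) simp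
        moreover have "\<forall>\<^sub>F y in nhds t. 0 < y 0"
          using coord pos bounds[OF t] by (intro order_tendstoD(1)) auto
        ultimately show ?thesis
          using base away
        proof eventually_elim
          case (elim y)
          then show ?case
            using shrink_close[OF pos _ elim(1) _ \<open>1 \<le> m\<close>, of "\<sigma> (?q y)" "\<sigma> (?q t)"] by auto
        qed
      qed
    qed
  qed
  then show ?thesis
    unfolding integer_cone_def restrict_in_close_simplices by (simp add: locally_close_def)
qed

lemma face_0_integer_cone:
  assumes "\<sigma> \<in> extensional (standard_simplex p)"
  shows "singular_face (Suc p) 0 (integer_cone p \<sigma>) = \<sigma>"
proof
  fix x
  show "singular_face (Suc p) 0 (integer_cone p \<sigma>) x = \<sigma> x"
  proof (cases "x \<in> standard_simplex p")
    case True
    then have "simplical_face 0 x \<in> standard_simplex (Suc p)"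
      by (intro simplical_face_in_standard_simplex) auto
    with True show ?thesis
      by (simp add: singular_face_def integer_cone_def) (simp add: simplical_face_def)
  qed (use assms in \<open>simp add: singular_face_def extensional_def\<close>)
qed

lemma face_Suc_integer_cone:
  assumes "1 \<le> p" "k \<le> p"
  shows "singular_face (Suc p) (Suc k) (integer_cone p \<sigma>) = integer_cone (p - 1) (singular_face p k \<sigma>)"
proof
  fix x
  have p: "Suc (p - Suc 0) = p"
    using assms by simp
  show "singular_face (Suc p) (Suc k) (integer_cone p \<sigma>) x = integer_cone (p - 1) (singular_face p k \<sigma>) x"
  proof (cases "x \<in> standard_simplex p")
    case True
    then have face: "simplical_face (Suc k) x \<in> standard_simplex (Suc p)"
      using assms by (intro simplical_face_in_standard_simplex) auto
    have "singular_face (Suc p) (Suc k) (integer_cone p \<sigma>) x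
        = shrink (x 0) (\<sigma> (\<lambda>i. simplical_face (Suc k) x (Suc i) / (1 - x 0)))"
      using True face by (simp add: singular_face_def integer_cone_def) (simp add: simplical_face_def)
    also have "(\<lambda>i. simplical_face (Suc k) x (Suc i) / (1 - x 0)) = simplical_face k (\<lambda>i. x (Suc i) / (1 - x 0))"
      by (auto simp: simplical_face_def fun_eq_iff)
    also have "shrink (x 0) (\<sigma> \<dots>) = integer_cone (p - 1) (singular_face p k \<sigma>) x"
    proof (cases "x 0 = 1")
      case False
      then have "(\<lambda>i. x (Suc i) / (1 - x 0)) \<in> standard_simplex (p - Suc 0)"
        using True p by (intro radial_projection_in_simplex) auto
      then show ?thesis
        using True by (simp add: integer_cone_def singular_face_def p)
    qed (use True in \<open>simp add: integer_cone_def p shrink_late\<close>)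
    finally show ?thesis .
  qed (simp add: singular_face_def integer_cone_def p)
qed

text \<open>For \<open>m = 0\<close> the integers are discrete and clamping is not continuous; but then simplices are
  constant and the cone may be taken with apex at that constant value.\<close>

lemma integers_acyclic:
  assumes "0 \<le> m" "1 \<le> p"
    and z: "Poly_Mapping.keys z \<subseteq> close_simplices (\<lambda>i j. \<bar>j - i\<bar> \<le> m) UNIV p" "chain_boundary p z = 0"
  shows "\<exists>w. Poly_Mapping.keys w \<subseteq> close_simplices (\<lambda>i j. \<bar>j - i\<bar> \<le> (m::int)) UNIV (Suc p) \<and> chain_boundary (Suc p) w = z"
proof (cases "m = 0")
  case False
  then have "1 \<le> m"
    using assms(1) by simp
  with assms(2-) show ?thesis
    by (intro cone_operator_acyclic[where K = integer_cone] integer_cone_in_close_simplices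
        face_0_integer_cone face_Suc_integer_cone close_simplices_extensional) auto
next
  case True
  let ?v = "\<lambda>j::nat. if j = 0 then 1 else 0 :: real"
  let ?S = "close_simplices (\<lambda>i j. \<bar>j - i\<bar> \<le> m) UNIV"
  \<comment> \<open>A constant simplex is coned off by the constant simplex of one dimension more.\<close>
  let ?K = "\<lambda>p (\<sigma> :: _ \<Rightarrow> int). restrict (\<lambda>_. \<sigma> ?v) (standard_simplex (Suc p))"
  have const: "\<sigma> x = \<sigma> ?v" if "\<sigma> \<in> ?S p" "x \<in> standard_simplex p" for \<sigma> x
  proof (rule locally_close_eq_imp_constant[where S = "standard_simplex p" and f = \<sigma>])
    have "locally_close (\<lambda>i j. \<bar>j - i\<bar> \<le> m) (standard_simplex p) \<sigma>"
      using that(1) by (simp add: close_simplices_def)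
    from locally_close_mono[OF this, of "(=)" id] True show "locally_close (=) (standard_simplex p) \<sigma>"
      by simp
    show "connected (standard_simplex p)"
      using connectedin_standard_simplex[of p] by (simp add: euclidean_product_topology)
  qed (use that in simp_all)
  show ?thesis
  proof (rule cone_operator_acyclic[where K = ?K and S = ?S, OF \<open>1 \<le> p\<close> z])
    fix \<sigma> assume \<sigma>: "\<sigma> \<in> ?S p"
    show "?K p \<sigma> \<in> ?S (Suc p)"
      using True by (simp only: restrict_in_close_simplices) (simp add: locally_close_def)
    show "singular_face (Suc p) 0 (?K p \<sigma>) = \<sigma>"
    proof
      fix x
      show "singular_face (Suc p) 0 (?K p \<sigma>) x = \<sigma> x"
      proof (cases "x \<in> standard_simplex p")
        case True
        then have "simplical_face 0 x \<in> standard_simplex (Suc p)"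
          by (intro simplical_face_in_standard_simplex) auto
        with True show ?thesis
          using const[OF \<sigma> True] by (simp add: singular_face_def)
      qed (use close_simplices_extensional[OF \<sigma>] in \<open>simp add: singular_face_def extensional_def\<close>)
    qed
    fix k assume k: "k \<le> p"
    have "?v \<in> standard_simplex (p - 1)"
      by simp
    with k \<open>1 \<le> p\<close> have "simplical_face k ?v \<in> standard_simplex p"
      by (intro simplical_face_in_standard_simplex) auto
    from const[OF \<sigma> this] have v: "singular_face p k \<sigma> ?v = \<sigma> ?v"
      by (simp add: singular_face_def)
    show "singular_face (Suc p) (Suc k) (?K p \<sigma>) = ?K (p - 1) (singular_face p k \<sigma>)"
    proof
      fix x
      show "singular_face (Suc p) (Suc k) (?K p \<sigma>) x = ?K (p - 1) (singular_face p k \<sigma>) x"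
      proof (cases "x \<in> standard_simplex p")
        case True
        then have "simplical_face (Suc k) x \<in> standard_simplex (Suc p)"
          using k by (intro simplical_face_in_standard_simplex) auto
        with True show ?thesis
          using v \<open>1 \<le> p\<close> by (simp add: singular_face_def[of "Suc p"])
      qed (use \<open>1 \<le> p\<close> in \<open>simp add: singular_face_def[of "Suc p"]\<close>)
    qed
  qed
qed

section \<open>The covering of the cyclic closure space by the integers\<close>

abbreviation integer_simplices :: "int \<Rightarrow> nat \<Rightarrow> ((nat \<Rightarrow> real) \<Rightarrow> int) set" where
  "integer_simplices m \<equiv> close_simplices (\<lambda>i j. \<bar>j - i\<bar> \<le> m) UNIV"

abbreviation cyclic_simplices :: "int \<Rightarrow> int \<Rightarrow> nat \<Rightarrow> ((nat \<Rightarrow> real) \<Rightarrow> int) set" where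
  "cyclic_simplices n m \<equiv> close_simplices (cyclically_close n m) {0..<n}"

text \<open>A simplex is compact and contracts along straight lines to its first vertex.\<close>

lemma simplex_lift_exists:
  assumes \<sigma>: "\<sigma> \<in> cyclic_simplices n m p" and "3 * m < n"
  shows "\<exists>\<tau>\<in>integer_simplices m p. simplex_map p (\<lambda>i. i mod n) \<tau> = \<sigma>"
proof -
  let ?S = "standard_simplex p"
  let ?v = "\<lambda>j::nat. if j = 0 then 1 else 0 :: real"
  let ?h = "\<lambda>x s j. (1 - s) * ?v j + s * x j"
  have compact: "compact ?S"
    using compactin_standard_simplex[of p] by (simp add: euclidean_product_topology)
  have close: "locally_close (cyclically_close n m) ?S \<sigma>"
    using \<sigma> by (simp add: close_simplices_def)
  have cont: "continuous_on (?S \<times> {0..1}) (\<lambda>(x, s). ?h x s)"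
  proof -
    have "continuous_on (?S \<times> {0..1}) (\<lambda>z. fst z j)" for j
      by (rule continuous_on_product_then_coordinatewise) (intro continuous_intros)
    then show ?thesis
      unfolding case_prod_unfold
      by (intro continuous_on_coordinatewise_then_product continuous_intros)
  qed
  have into: "?h x s \<in> ?S" if "x \<in> ?S" "s \<in> {0..1}" for x s
    using convex_standard_simplex[of ?v p x s] that by simp
  obtain L where L: "locally_close (\<lambda>i j. \<bar>j - i\<bar> \<le> m) ?S L"
      "\<And>x. x \<in> ?S \<Longrightarrow> [L x = \<sigma> x] (mod n)"
    by (rule lift_exists[where h = ?h and a = ?v, OF compact close assms(2) cont into]) auto
  show ?thesis
  proof
    show "restrict L ?S \<in> integer_simplices m p"
      using L(1) by (simp add: restrict_in_close_simplices)
    have "L x mod n = \<sigma> x" if "x \<in> ?S" for x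
      using L(2)[OF that] close_simplices_mapsto[OF \<sigma> that] by (simp add: cong_def)
    then show "simplex_map p (\<lambda>i. i mod n) (restrict L ?S) = \<sigma>"
      using close_simplices_extensional[OF \<sigma>] by (auto simp: simplex_map_def fun_eq_iff extensional_def)
  qed
qed

text \<open>The difference of two lifts is a multiple of \<open>n\<close> that changes by at most \<open>2m < n\<close> near each
  point, hence is constant on the connected simplex.\<close>

lemma simplex_lifts_differ_by_translation:
  assumes \<sigma>: "\<sigma> \<in> integer_simplices m p" and \<tau>: "\<tau> \<in> integer_simplices m p" and "2 * m < n"
    and eq: "simplex_map p (\<lambda>i. i mod n) \<sigma> = simplex_map p (\<lambda>i. i mod n) \<tau>"
  shows "\<exists>a. \<sigma> = simplex_map p (\<lambda>i. i + a * n) \<tau>"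
proof -
  let ?S = "standard_simplex p"
  let ?v = "\<lambda>j::nat. if j = 0 then 1 else 0 :: real"
  let ?d = "\<lambda>x. \<sigma> x - \<tau> x"
  have dvd: "n dvd ?d x" if "x \<in> ?S" for x
    using fun_cong[OF eq, of x] that by (simp add: simplex_map_def mod_eq_dvd_iff)
  have "locally_close (=) ?S ?d"
    unfolding locally_close_def
  proof
    fix x assume x: "x \<in> ?S"
    have same: "?d x = ?d y" if "y \<in> ?S" "\<bar>\<sigma> y - \<sigma> x\<bar> \<le> m" "\<bar>\<tau> y - \<tau> x\<bar> \<le> m" for y
    proof (rule cong_imp_eq_int)
      show "[?d x = ?d y] (mod n)"
        using dvd x that(1) by (simp add: cong_iff_dvd_diff)
    qed (use that assms(3) in linarith)
    have "\<forall>\<^sub>F y in nhds x. y \<in> ?S \<longrightarrow> \<bar>\<sigma> y - \<sigma> x\<bar> \<le> m" "\<forall>\<^sub>F y in nhds x. y \<in> ?S \<longrightarrow> \<bar>\<tau> y - \<tau> x\<bar> \<le> m"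
      using \<sigma> \<tau> x by (simp_all add: close_simplices_def locally_close_def)
    then show "\<forall>\<^sub>F y in nhds x. y \<in> ?S \<longrightarrow> ?d x = ?d y"
      by eventually_elim (use same in blast)
  qed
  moreover have "connected ?S"
    using connectedin_standard_simplex[of p] by (simp add: euclidean_product_topology)
  ultimately have const: "?d x = ?d ?v" if "x \<in> ?S" for x
    using that by (intro locally_close_eq_imp_constant[where f = ?d]) auto
  obtain a where "?d ?v = n * a"
    using dvd[of ?v] by auto
  then have "\<sigma> x = \<tau> x + a * n" if "x \<in> ?S" for x
    using const[OF that] by (simp add: algebra_simps)
  then have "\<sigma> = simplex_map p (\<lambda>i. i + a * n) \<tau>"
    using close_simplices_extensional[OF \<sigma>] by (auto simp: simplex_map_def fun_eq_iff extensional_def)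
  then show ?thesis ..
qed

lemma chain_lift_exists:
  assumes "Poly_Mapping.keys z \<subseteq> cyclic_simplices n m p" and "3 * m < n"
  shows "\<exists>y. Poly_Mapping.keys y \<subseteq> integer_simplices m p \<and> chain_map p (\<lambda>i. i mod n) y = z"
  using assms(1)
proof (induction z rule: frag_induction)
  case zero
  show ?case
    by (intro exI[of _ 0]) simp
next
  case (one \<sigma>)
  then obtain \<tau> where "\<tau> \<in> integer_simplices m p" "simplex_map p (\<lambda>i. i mod n) \<tau> = \<sigma>"
    using simplex_lift_exists assms(2) by blast
  then show ?case
    by (intro exI[of _ "frag_of \<tau>"]) simp
next
  case (diff a b)
  then obtain y y' where "Poly_Mapping.keys y \<subseteq> integer_simplices m p" "chain_map p (\<lambda>i. i mod n) y = a"
      "Poly_Mapping.keys y' \<subseteq> integer_simplices m p" "chain_map p (\<lambda>i. i mod n) y' = b"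
    by blast
  then show ?case
    using keys_diff[of y y'] by (intro exI[of _ "y - y'"]) (auto simp: chain_map_diff)
qed

lemma simplex_map_translate:
  "simplex_map p (\<lambda>i. i + a) (simplex_map p (\<lambda>i. i + b) \<sigma>) = simplex_map p (\<lambda>i. i + (b + a :: int)) \<sigma>"
  by (auto simp: simplex_map_def fun_eq_iff add.assoc)

lemma translate_integer_simplex:
  "\<sigma> \<in> integer_simplices m p \<Longrightarrow> simplex_map p (\<lambda>i. i + a) \<sigma> \<in> integer_simplices m p"
  by (rule simplex_map_in_close_simplices) auto

text \<open>The factorisation \<open>t\<^sup>a - 1 = (t - 1)(t\<^sup>a\<^sup>-\<^sup>1 + \<dots> + t + 1)\<close>, applied to a simplex; by induction
  in both directions it also covers negative \<open>a\<close>.\<close>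

lemma translate_minus_self:
  assumes \<tau>: "\<tau> \<in> integer_simplices m p"
  shows "\<exists>w. Poly_Mapping.keys w \<subseteq> integer_simplices m p \<and>
    frag_of (simplex_map p (\<lambda>i. i + a * n) \<tau>) - frag_of \<tau> = chain_map p (\<lambda>i. i + n) w - w"
proof (induction a rule: int_induct[where k = 0])
  case base
  have "simplex_map p (\<lambda>i. i + 0 * n) \<tau> = \<tau>"
    using close_simplices_extensional[OF \<tau>] by (auto simp: simplex_map_def fun_eq_iff extensional_def)
  then show ?case
    by (intro exI[of _ 0]) simp
next
  case (step1 a)
  let ?\<sigma> = "simplex_map p (\<lambda>i. i + a * n) \<tau>"
  obtain w where w: "Poly_Mapping.keys w \<subseteq> integer_simplices m p"
      "frag_of ?\<sigma> - frag_of \<tau> = chain_map p (\<lambda>i. i + n) w - w"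
    using step1 by blast
  have "Poly_Mapping.keys (w + frag_of ?\<sigma>) \<subseteq> integer_simplices m p"
    using w(1) keys_add[of w "frag_of ?\<sigma>"] translate_integer_simplex[OF \<tau>] by (auto simp: keys_frag_of)
  moreover have "simplex_map p (\<lambda>i. i + n) ?\<sigma> = simplex_map p (\<lambda>i. i + (a + 1) * n) \<tau>"
    by (simp add: simplex_map_translate algebra_simps)
  moreover have "chain_map p (\<lambda>i. i + n) w = frag_of ?\<sigma> - frag_of \<tau> + w"
    by (simp add: w(2))
  ultimately show ?case
    by (intro exI[of _ "w + frag_of ?\<sigma>"]) (simp add: chain_map_add)
next
  case (step2 a)
  let ?\<sigma> = "simplex_map p (\<lambda>i. i + (a - 1) * n) \<tau>"
  obtain w where w: "Poly_Mapping.keys w \<subseteq> integer_simplices m p"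
      "frag_of (simplex_map p (\<lambda>i. i + a * n) \<tau>) - frag_of \<tau> = chain_map p (\<lambda>i. i + n) w - w"
    using step2 by blast
  have "Poly_Mapping.keys (w - frag_of ?\<sigma>) \<subseteq> integer_simplices m p"
    using w(1) keys_diff[of w "frag_of ?\<sigma>"] translate_integer_simplex[OF \<tau>] by (auto simp: keys_frag_of)
  moreover have "simplex_map p (\<lambda>i. i + n) ?\<sigma> = simplex_map p (\<lambda>i. i + a * n) \<tau>"
    unfolding simplex_map_translate by (simp add: algebra_simps)
  moreover have "chain_map p (\<lambda>i. i + n) w = frag_of (simplex_map p (\<lambda>i. i + a * n) \<tau>) - frag_of \<tau> + w"
    by (simp add: w(2))
  ultimately show ?case
    by (intro exI[of _ "w - frag_of ?\<sigma>"]) (simp add: chain_map_diff)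
qed

text \<open>Choose a lift \<open>L \<sigma>\<close> for each simplex \<open>\<sigma>\<close> downstairs. Every simplex upstairs is a translate of the
  chosen lift of its projection, so \<open>x - L (\<pi> x)\<close> lies in the image of \<open>t - 1\<close> for every chain \<open>x\<close>,
  and \<open>L (\<pi> x) = 0\<close> on the kernel of \<open>\<pi>\<close>.\<close>

lemma kernel_of_projection:
  assumes x: "Poly_Mapping.keys x \<subseteq> integer_simplices m p" "chain_map p (\<lambda>i. i mod n) x = 0"
    and "0 \<le> m" "3 * m < n"
  shows "\<exists>w. Poly_Mapping.keys w \<subseteq> integer_simplices m p \<and> x = chain_map p (\<lambda>i. i + n) w - w"
proof -
  let ?\<pi> = "simplex_map p (\<lambda>i. i mod n)"
  define L where "L \<sigma> = (SOME \<tau>. \<tau> \<in> integer_simplices m p \<and> ?\<pi> \<tau> = \<sigma>)" for \<sigma>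
  have L: "L (?\<pi> \<sigma>) \<in> integer_simplices m p" "?\<pi> (L (?\<pi> \<sigma>)) = ?\<pi> \<sigma>" if "\<sigma> \<in> integer_simplices m p" for \<sigma>
    using someI[of "\<lambda>\<tau>. \<tau> \<in> integer_simplices m p \<and> ?\<pi> \<tau> = ?\<pi> \<sigma>" \<sigma>] that by (auto simp: L_def)
  have "\<exists>w. Poly_Mapping.keys w \<subseteq> integer_simplices m p \<and>
      x - frag_extend (frag_of \<circ> L) (chain_map p (\<lambda>i. i mod n) x) = chain_map p (\<lambda>i. i + n) w - w"
    using x(1)
  proof (induction x rule: frag_induction)
    case zero
    show ?case
      by (intro exI[of _ 0]) simp
  next
    case (one \<sigma>)
    obtain a where "\<sigma> = simplex_map p (\<lambda>i. i + a * n) (L (?\<pi> \<sigma>))"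
      using simplex_lifts_differ_by_translation[OF one L(1)[OF one] _ L(2)[OF one, symmetric]] assms by fastforce
    then show ?case
      using translate_minus_self[OF L(1)[OF one], of a n] by simp
  next
    case (diff a b)
    then obtain w w' where w: "Poly_Mapping.keys w \<subseteq> integer_simplices m p"
      "a - frag_extend (frag_of \<circ> L) (chain_map p (\<lambda>i. i mod n) a) = chain_map p (\<lambda>i. i + n) w - w"
      "Poly_Mapping.keys w' \<subseteq> integer_simplices m p"
      "b - frag_extend (frag_of \<circ> L) (chain_map p (\<lambda>i. i mod n) b) = chain_map p (\<lambda>i. i + n) w' - w'"
      by blast
    have "Poly_Mapping.keys (w - w') \<subseteq> integer_simplices m p"
      using keys_diff[of w w'] w(1,3) by blast
    moreover have "chain_map p (\<lambda>i. i + n) (w - w') - (w - w')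
        = (chain_map p (\<lambda>i. i + n) w - w) - (chain_map p (\<lambda>i. i + n) w' - w')"
      by (simp add: chain_map_diff)
    ultimately show ?case
      unfolding w(2)[symmetric] w(4)[symmetric]
      by (intro exI[of _ "w - w'"]) (simp add: chain_map_diff frag_extend_diff comp_def)
  qed
  then show ?thesis
    using x(2) by simp
qed

lemma lookup_frag_extend_inj:
  assumes "Poly_Mapping.keys c \<subseteq> S" "inj_on s S" "a \<in> S"
  shows "Poly_Mapping.lookup (frag_extend (frag_of \<circ> s) c) (s a) = Poly_Mapping.lookup c a"
  using assms(1)
proof (induction c rule: frag_induction)
  case (one b)
  then show ?case
    using assms(2,3) by (auto simp: inj_on_def)
qed (auto simp: frag_extend_diff lookup_minus)

text \<open>Injectivity of \<open>t - 1\<close>: among the finitely many simplices of an invariant chain, one with the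
  largest value at the first vertex has its translate in the chain as well, with a larger value.\<close>

lemma translation_invariant_chain_eq_0:
  assumes x: "Poly_Mapping.keys x \<subseteq> extensional (standard_simplex p)" "chain_map p (\<lambda>i. i + n) x = x" and "0 < (n::int)"
  shows "x = 0"
proof (rule ccontr)
  assume "x \<noteq> 0"
  let ?v = "\<lambda>j::nat. if j = 0 then 1 else 0 :: real"
  let ?E = "(\<lambda>\<sigma>. \<sigma> ?v) ` Poly_Mapping.keys x"
  have fin: "finite ?E" "?E \<noteq> {}"
    using \<open>x \<noteq> 0\<close> by auto
  from Max_in[OF this] obtain \<sigma> where \<sigma>: "\<sigma> \<in> Poly_Mapping.keys x" "\<sigma> ?v = Max ?E"
    by force
  have "inj_on (simplex_map p (\<lambda>i. i + n)) (extensional (standard_simplex p))"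
  proof (rule inj_onI)
    fix \<sigma> \<tau> :: "(nat \<Rightarrow> real) \<Rightarrow> int"
    assume ext: "\<sigma> \<in> extensional (standard_simplex p)" "\<tau> \<in> extensional (standard_simplex p)"
      and eq: "simplex_map p (\<lambda>i. i + n) \<sigma> = simplex_map p (\<lambda>i. i + n) \<tau>"
    show "\<sigma> = \<tau>"
    proof (rule extensionalityI[OF ext])
      show "\<sigma> y = \<tau> y" if "y \<in> standard_simplex p" for y
        using fun_cong[OF eq, of y] that by (simp add: simplex_map_def)
    qed
  qed
  from lookup_frag_extend_inj[OF x(1) this] x \<sigma>(1)
  have "simplex_map p (\<lambda>i. i + n) \<sigma> \<in> Poly_Mapping.keys x"
    by (metis chain_map_def in_keys_iff subsetD)
  then have "simplex_map p (\<lambda>i. i + n) \<sigma> ?v \<le> Max ?E"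
    using fin by (intro Max_ge) auto
  then show False
    using \<sigma>(2) \<open>0 < n\<close> by (simp add: simplex_map_def)
qed

text \<open>Lift a cycle \<open>z\<close> to a chain \<open>y\<close> of the integers. Its boundary projects to 0, so
  \<open>\<partial>y = (t - 1) w\<close>. Injectivity of \<open>t - 1\<close> makes \<open>w\<close> a cycle, of degree \<open>p - 1 \<ge> 1\<close>, so \<open>w = \<partial>v\<close>.
  Then \<open>y - (t - 1) v\<close> is a cycle as well, hence equal to \<open>\<partial>u\<close> for some \<open>u\<close>, and it still projects to \<open>z\<close>; so
  \<open>z = \<partial>(\<pi> u)\<close>.\<close>

lemma cyclic_acyclic:
  assumes "0 \<le> m" "3 * m < n" "2 \<le> p"
    and z: "Poly_Mapping.keys z \<subseteq> cyclic_simplices n m p" "chain_boundary p z = 0"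
  shows "\<exists>w. Poly_Mapping.keys w \<subseteq> cyclic_simplices n m (Suc p) \<and> chain_boundary (Suc p) w = z"
proof -
  have n: "0 < n"
    using assms(1,2) by simp
  define T where "T q = chain_map q (\<lambda>i. i + n)" for q
  define P where "P q = chain_map q (\<lambda>i. i mod n)" for q
  let ?C = "\<lambda>q. {c. Poly_Mapping.keys c \<subseteq> integer_simplices m q}"
  have ext: "Poly_Mapping.keys c \<subseteq> extensional (standard_simplex q)" if "c \<in> ?C q" for c q
    using that by (auto dest: close_simplices_extensional)
  have boundary: "chain_boundary q c \<in> ?C (q - 1)" if "c \<in> ?C q" for c q
    using that unfolding mem_Collect_eq by (rule chain_boundary_keys)
  have diff: "c - c' \<in> ?C q" if "c \<in> ?C q" "c' \<in> ?C q" for c c' q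
    using that keys_diff[of c c'] by auto
  have T: "T q c \<in> ?C q" "chain_boundary q (T q c) = T (q - 1) (chain_boundary q c)"
      "P q (T q c) = P q c" if "c \<in> ?C q" for c q
  proof -
    show "T q c \<in> ?C q"
      unfolding T_def using that chain_map_keys translate_integer_simplex by blast
    show "chain_boundary q (T q c) = T (q - 1) (chain_boundary q c)"
      unfolding T_def by (rule chain_boundary_chain_map_extensional[OF ext[OF that]])
    have "chain_map q ((\<lambda>i. i mod n) \<circ> (\<lambda>i. i + n)) = P q \<circ> T q"
      unfolding P_def T_def by (rule chain_map_compose)
    then show "P q (T q c) = P q c"
      by (simp add: P_def comp_def fun_eq_iff)
  qed
  have P: "chain_boundary q (P q c) = P (q - 1) (chain_boundary q c)" if "c \<in> ?C q" for c q
    unfolding P_def by (rule chain_boundary_chain_map_extensional[OF ext[OF that]])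
  obtain y where y: "y \<in> ?C p" "P p y = z"
    using chain_lift_exists[OF z(1) assms(2)] by (auto simp: P_def)
  then have "P (p - 1) (chain_boundary p y) = 0"
    using P[OF y(1)] z(2) by simp
  then obtain w where w: "w \<in> ?C (p - 1)" "chain_boundary p y = T (p - 1) w - w"
    using kernel_of_projection[of "chain_boundary p y" m "p - 1" n] boundary[OF y(1)] assms(1,2)
    by (auto simp: P_def T_def)
  have "chain_boundary (p - 1) (chain_boundary p y) = 0"
    using chain_boundary_boundary_extensional[of y "p - 1"] ext[OF y(1)] \<open>2 \<le> p\<close> by simp
  then have "T (p - 1 - 1) (chain_boundary (p - 1) w) = chain_boundary (p - 1) w"
    unfolding w(2) chain_boundary_diff T(2)[OF w(1)] by simp
  then have cycle: "chain_boundary (p - 1) w = 0"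
    unfolding T_def by (rule translation_invariant_chain_eq_0[OF ext[OF boundary[OF w(1)]] _ n])
  then obtain v where v: "v \<in> ?C p" "chain_boundary p v = w"
  proof -
    have "1 \<le> p - 1" "Suc (p - 1) = p"
      using \<open>2 \<le> p\<close> by simp_all
    then show ?thesis
      using integers_acyclic[of m "p - 1" w] w(1) cycle assms(1) that by auto
  qed
  have "chain_boundary p (y - (T p v - v)) = 0"
    by (simp only: chain_boundary_diff T(2)[OF v(1)] v(2) w(2)) simp
  moreover have "y - (T p v - v) \<in> ?C p"
    by (intro diff y(1) T(1)[OF v(1)] v(1))
  ultimately obtain u where u: "u \<in> ?C (Suc p)" "chain_boundary (Suc p) u = y - (T p v - v)"
  proof -
    have "1 \<le> p"
      using \<open>2 \<le> p\<close> by simp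
    from integers_acyclic[OF assms(1) this, of "y - (T p v - v)"] show ?thesis
      using \<open>y - (T p v - v) \<in> ?C p\<close> \<open>chain_boundary p (y - (T p v - v)) = 0\<close> that by blast
  qed
  have "chain_boundary (Suc p) (P (Suc p) u) = P p (y - (T p v - v))"
    using P[OF u(1)] u(2) by simp
  also have "\<dots> = P p y - (P p (T p v) - P p v)"
    by (simp add: P_def chain_map_diff)
  also have "\<dots> = z"
    using T(3)[OF v(1)] y(2) by simp
  finally have "chain_boundary (Suc p) (P (Suc p) u) = z" .
  moreover have "Poly_Mapping.keys (P (Suc p) u) \<subseteq> cyclic_simplices n m (Suc p)"
    unfolding P_def
  proof (rule chain_map_keys[of u "integer_simplices m (Suc p)"])
    fix \<sigma> assume "\<sigma> \<in> integer_simplices m (Suc p)"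
    then show "simplex_map (Suc p) (\<lambda>i. i mod n) \<sigma> \<in> cyclic_simplices n m (Suc p)"
    proof (rule simplex_map_in_close_simplices)
      show "cyclically_close n m (i mod n) (j mod n)" if "\<bar>j - i\<bar> \<le> m" for i j
        unfolding cyclically_close_def using that
        by (intro exI[of _ "j - i"]) (simp add: cong_def mod_diff_eq)
    qed (use n in auto)
  qed (use u(1) in simp)
  ultimately show ?thesis
    by blast
qed

text \<open>The infimum defining the distance is attained, being taken over natural numbers.\<close>

lemma Zn_dist_le_iff:
  "Zn_dist n i j \<le> m \<longleftrightarrow> cyclically_close (int n) (int m) j i"
proof -
  let ?A = "{nat \<bar>k\<bar> |k. [k = i - j] (mod int n)}"
  have "?A \<noteq> {}"
    by (auto intro: exI[of _ "i - j"])
  then have "Inf ?A \<in> ?A"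
    by (rule Inf_nat_def1)
  then obtain k where k: "Inf ?A = nat \<bar>k\<bar>" "[k = i - j] (mod int n)"
    by blast
  have "Inf ?A \<le> nat \<bar>k\<bar>" if "[k = i - j] (mod int n)" for k
    using that by (intro cInf_lower) auto
  then show ?thesis
    unfolding Zn_dist_def cyclically_close_def
    using k by (metis (no_types, lifting) nat_le_iff order_trans)
qed

theorem theorem5p16:
  fixes n m k :: nat
  assumes "n \<ge> 1" and "n \<ge> 4 * m" and "k \<ge> 2"
  shows "trivial_group (closure_homology_group k (Zn n) (Zn_closure n m))"
proof (rule trivial_closure_homology_group)
  show "{f. closure_singular_simplex q (Zn n) (Zn_closure n m) f}
      = close_simplices (cyclically_close (int n) (int m)) (Zn n) q" for q
    by (rule closure_singular_simplices_eq_close_simplices) (auto simp: Zn_closure_def Zn_dist_le_iff)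
  show "\<exists>w. Poly_Mapping.keys w \<subseteq> close_simplices (cyclically_close (int n) (int m)) (Zn n) (Suc k) \<and>
        chain_boundary (Suc k) w = z"
    if "Poly_Mapping.keys z \<subseteq> close_simplices (cyclically_close (int n) (int m)) (Zn n) k" "chain_boundary k z = 0" for z
    using that cyclic_acyclic[of "int m" "int n" k z] assms by (simp add: Zn_def)
qed

end
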